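(* Let $(W,\lambda)$ be a Liouville domain. Then $\mathcal H(W,\lambda)$ can be equipped with a Lawvere metric category structure, denoted ${\rm Tun}(W,\lambda)$. Explicitly, ${\rm Ob}({\rm Tun}(W,\lambda)):=\mathcal H(W,\lambda)$ and, for objects $H,G$, $${\rm hom}_{{\rm Tun}(W,\lambda)}(H,G):=\inf_{\psi\in{\rm Symp}(W,\lambda)}\max\left\{\ln\left(\sup_{(t,w)\in S^1\times{\rm Int}(W)}\frac{H(t,w)}{G(t,\psi(w))}\right),0\right\},$$ and the following two properties hold: (i) ${\rm hom}_{{\rm Tun}(W,\lambda)}(H,H)=0$ for every object $H$; (ii) ${\rm hom}_{{\rm Tun}(W,\lambda)}(H_1,H_3)\le{\rm hom}_{{\rm Tun}(W,\lambda)}(H_1,H_2)+{\rm hom}_{{\rm Tun}(W,\lambda)}(H_2,H_3)$ for all objects $H_1,H_2,H_3$. Moreover, defining the symmetrization $${\rm hom}^{\rm sym}_{{\rm Tun}(W,\lambda)}(H,G):=\inf_{\psi\in{\rm Symp}(W,\lambda)}\ln\left(\sup_{(t,w)\in S^1\times{\rm Int}(W)}\max\left\{\frac{H(t,w)}{G(t,\psi(w))},\frac{G(t,\psi(w))}{H(t,w)}\right\}\right),$$ one has ${\rm hom}^{\rm sym}_{{\rm Tun}(W,\lambda)}(H,G)=d_{\rm T}(H,G)$.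
   Context: A Liouville domain $(W,\lambda)$ is a compact exact symplectic manifold with boundary (symplectic form $d\lambda$) whose Liouville vector field $Y_\lambda$, defined by $\iota_{Y_\lambda}d\lambda=\lambda$, is outward transverse to $\partial W$. ${\rm Symp}(W,\lambda)$ is the group of diffeomorphisms $\psi$ of $W$ with $\psi^*\lambda=\lambda$. Let $S^1=\mathbb R/\mathbb Z$. For smooth $H:S^1\times W\to\mathbb R$ put $H_t=H(t,\cdot)$, define $X_{H_t}$ by $\iota_{X_{H_t}}d\lambda=dH_t$, and $\tau_{\lambda,H}=\lambda(X_{H_t})+H$. $\mathcal H(W,\lambda)$ is the set of smooth $H:S^1\times W\to\mathbb R$ which are autonomous (independent of $t$) in a neighborhood of $\partial W$, vanish on $\partial W$, and satisfy $\tau_{\lambda,H}>0$ everywhere. (Such $H$ are positive on $S^1\times{\rm Int}(W)$.) A Lawvere metric category is a category enriched in the monoidal poset $([0,\infty],\ge,+,0)$, i.e. a class of objects with values ${\rm hom}(x,y)\in[0,\infty]$ satisfying properties (i) and (ii) above. The Thompson-type distance is $d_{\rm T}(H,G)=\inf\{\ln C\ge0\mid\exists\,\varphi\in{\rm Symp}(W,\lambda)\text{ with }\frac1CH\le G\circ\varphi\le CH\}$, where $(G\circ\varphi)(t,w)=G(t,\varphi(w))$. *)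

theory Defs
  imports "HOL-Analysis.Analysis"
begin

subsection \<open>Smooth maps\<close>

fun Ck_on :: "nat \<Rightarrow> ('a::euclidean_space \<Rightarrow> 'b::euclidean_space) \<Rightarrow> 'a set \<Rightarrow> bool" where
  "Ck_on 0 f N = continuous_on N f"
| "Ck_on (Suc k) f N = ((\<forall>x\<in>N. f differentiable at x) \<and>
      (\<forall>v. Ck_on k (\<lambda>x. frechet_derivative f (at x) v) N))"

text \<open>On a set that need not be open, smooth means locally extendable to a smooth map on
  an open set. This is the usual notion for relatively open subsets of a half-space.\<close>

definition smooth_on :: "'a::euclidean_space set \<Rightarrow> ('a \<Rightarrow> 'b::euclidean_space) \<Rightarrow> bool" where
  "smooth_on S f \<longleftrightarrow> (\<forall>x\<in>S. \<exists>N g. open N \<and> x \<in> N \<and> (\<forall>k. Ck_on k g N) \<and> (\<forall>y\<in>N \<inter> S. g y = f y))"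

subsection \<open>Manifolds with boundary\<close>

text \<open>The manifold is the whole type \<open>'w\<close>. Its charts take values in the half-space of
  \<open>'e \<times> real\<close> where the last coordinate is nonnegative, so its dimension
  \<open>DIM('e) + 1\<close> is at least 2 (as for every symplectic manifold of positive dimension).\<close>

definition half_space :: "('e::euclidean_space \<times> real) set" where
  "half_space = {x. 0 \<le> snd x}"

type_synonym ('w, 'e) chart = "'w set \<times> ('w \<Rightarrow> 'e \<times> real)"

definition cdom :: "('w, 'e) chart \<Rightarrow> 'w set" where "cdom c = fst c"
definition cmap :: "('w, 'e) chart \<Rightarrow> 'w \<Rightarrow> 'e \<times> real" where "cmap c = snd c"
definition cinv :: "('w, 'e) chart \<Rightarrow> 'e \<times> real \<Rightarrow> 'w" where "cinv c = inv_into (cdom c) (cmap c)"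

definition smooth_atlas :: "('w::t2_space, 'e::euclidean_space) chart set \<Rightarrow> bool" where
  "smooth_atlas A \<longleftrightarrow>
     (\<Union>c\<in>A. cdom c) = UNIV \<and>
     (\<forall>c\<in>A. open (cdom c) \<and> openin (top_of_set half_space) (cmap c ` cdom c) \<and>
        homeomorphism (cdom c) (cmap c ` cdom c) (cmap c) (cinv c)) \<and>
     (\<forall>c\<in>A. \<forall>d\<in>A. smooth_on (cmap c ` (cdom c \<inter> cdom d)) (cmap d \<circ> cinv c))"

definition boundary :: "('w, 'e::euclidean_space) chart set \<Rightarrow> 'w set" where
  "boundary A = {p. \<exists>c\<in>A. p \<in> cdom c \<and> snd (cmap c p) = 0}"

abbreviation Int_mfd :: "('w, 'e::euclidean_space) chart set \<Rightarrow> 'w set" where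
  "Int_mfd A \<equiv> - boundary A"

text \<open>Auxiliary choice of a chart around a point. It is only used to evaluate expressions whose
  value does not depend on the chart.\<close>

definition chart_at :: "('w, 'e) chart set \<Rightarrow> 'w \<Rightarrow> ('w, 'e) chart" where
  "chart_at A p = (SOME c. c \<in> A \<and> p \<in> cdom c)"

definition smooth_map :: "('w::t2_space, 'e::euclidean_space) chart set \<Rightarrow> ('w \<Rightarrow> 'w) \<Rightarrow> bool" where
  "smooth_map A \<psi> \<longleftrightarrow> continuous_on UNIV \<psi> \<and>
     (\<forall>c\<in>A. \<forall>d\<in>A. smooth_on (cmap c ` (cdom c \<inter> \<psi> -` cdom d)) (cmap d \<circ> \<psi> \<circ> cinv c))"

definition diffeo :: "('w::t2_space, 'e::euclidean_space) chart set \<Rightarrow> ('w \<Rightarrow> 'w) \<Rightarrow> bool" where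
  "diffeo A \<psi> \<longleftrightarrow> bij \<psi> \<and> smooth_map A \<psi> \<and> smooth_map A (inv \<psi>)"

subsection \<open>Differential forms\<close>

text \<open>Tensor fields are given by their coordinate expressions in all charts: for a chart \<open>c\<close>
  around \<open>p\<close>, a tangent vector at \<open>p\<close> is represented by its components in \<open>'e \<times> real\<close>, and
  \<open>\<theta> c p v\<close> is the value of the 1-form \<open>\<theta>\<close> on the tangent vector at \<open>p\<close> with components \<open>v\<close>
  in \<open>c\<close>. Values for \<open>p\<close> outside the domain of \<open>c\<close> are irrelevant.

  Derivatives are taken within the half-space: all functions concerned are defined on relatively
  open subsets of it, on which the derivative is unique also at boundary points.\<close>

type_synonym ('w, 'e) form1 = "('w, 'e) chart \<Rightarrow> 'w \<Rightarrow> 'e \<times> real \<Rightarrow> real"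
type_synonym ('w, 'e) form2 = "('w, 'e) chart \<Rightarrow> 'w \<Rightarrow> 'e \<times> real \<Rightarrow> 'e \<times> real \<Rightarrow> real"
type_synonym ('w, 'e) vfield = "('w, 'e) chart \<Rightarrow> 'w \<Rightarrow> 'e \<times> real"

abbreviation Dh :: "('e::euclidean_space \<times> real \<Rightarrow> 'b::real_normed_vector) \<Rightarrow> 'e \<times> real \<Rightarrow> 'e \<times> real \<Rightarrow> 'b" where
  "Dh f x \<equiv> frechet_derivative f (at x within half_space)"

definition one_form :: "('w::t2_space, 'e::euclidean_space) chart set \<Rightarrow> ('w, 'e) form1 \<Rightarrow> bool" where
  "one_form A \<theta> \<longleftrightarrow>
     (\<forall>c\<in>A. \<forall>p\<in>cdom c. linear (\<theta> c p)) \<and>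
     (\<forall>c\<in>A. \<forall>v. smooth_on (cmap c ` cdom c) (\<lambda>x. \<theta> c (cinv c x) v)) \<and>
     (\<forall>c\<in>A. \<forall>d\<in>A. \<forall>p\<in>cdom c \<inter> cdom d. \<forall>v.
        \<theta> c p v = \<theta> d p (Dh (cmap d \<circ> cinv c) (cmap c p) v))"

text \<open>The formula \<open>d\<theta>(V,W) = V(\<theta>(W)) - W(\<theta>(V)) - \<theta>([V,W])\<close> for vector fields \<open>V\<close>, \<open>W\<close> that are
  constant in the chart, so that the bracket vanishes.\<close>

definition ext_deriv :: "('w, 'e::euclidean_space) form1 \<Rightarrow> ('w, 'e) form2" where
  "ext_deriv \<theta> c p v w =
     Dh (\<lambda>x. \<theta> c (cinv c x) w) (cmap c p) v - Dh (\<lambda>x. \<theta> c (cinv c x) v) (cmap c p) w"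

definition differential :: "('w \<Rightarrow> real) \<Rightarrow> ('w, 'e::euclidean_space) form1" where
  "differential h c p = Dh (h \<circ> cinv c) (cmap c p)"

definition pullback :: "('w, 'e::euclidean_space) chart set \<Rightarrow> ('w \<Rightarrow> 'w) \<Rightarrow> ('w, 'e) form1 \<Rightarrow> ('w, 'e) form1" where
  "pullback A \<psi> \<theta> c p v =
     (let d = chart_at A (\<psi> p) in \<theta> d (\<psi> p) (Dh (cmap d \<circ> \<psi> \<circ> cinv c) (cmap c p) v))"

definition nondegenerate :: "('w, 'e::euclidean_space) chart set \<Rightarrow> ('w, 'e) form2 \<Rightarrow> bool" where
  "nondegenerate A \<omega> \<longleftrightarrow> (\<forall>c\<in>A. \<forall>p\<in>cdom c. \<forall>v. (\<forall>w. \<omega> c p v w = 0) \<longrightarrow> v = 0)"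

text \<open>The vector field \<open>X\<close> with \<open>\<iota>\<^sub>X d\<theta> = \<alpha>\<close>; it exists and is unique if \<open>d\<theta>\<close> is nondegenerate.\<close>

definition dual_vfield :: "('w, 'e::euclidean_space) form1 \<Rightarrow> ('w, 'e) form1 \<Rightarrow> ('w, 'e) vfield" where
  "dual_vfield \<theta> \<alpha> c p = (THE u. \<forall>v. ext_deriv \<theta> c p u v = \<alpha> c p v)"

subsection \<open>Liouville domains\<close>

text \<open>A tangent vector at a boundary point is transverse to the boundary and points outward iff its
  last component is negative.\<close>

definition liouville_domain :: "('w::t2_space, 'e::euclidean_space) chart set \<Rightarrow> ('w, 'e) form1 \<Rightarrow> bool" where
  "liouville_domain A \<theta> \<longleftrightarrow>
     compact (UNIV :: 'w set) \<and> smooth_atlas A \<and> one_form A \<theta> \<and> nondegenerate A (ext_deriv \<theta>) \<and>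
     (\<forall>c\<in>A. \<forall>p\<in>cdom c \<inter> boundary A. snd (dual_vfield \<theta> \<theta> c p) < 0)"

definition Symp :: "('w::t2_space, 'e::euclidean_space) chart set \<Rightarrow> ('w, 'e) form1 \<Rightarrow> ('w \<Rightarrow> 'w) set" where
  "Symp A \<theta> = {\<psi>. diffeo A \<psi> \<and> (\<forall>c\<in>A. \<forall>p\<in>cdom c. pullback A \<psi> \<theta> c p = \<theta> c p)}"

subsection \<open>Hamiltonians\<close>

quotient_type circle = real / "\<lambda>x y :: real. x - y \<in> \<int>"
  morphisms rep_circle proj_circle
proof (rule equivpI)
  show "reflp (\<lambda>x y :: real. x - y \<in> \<int>)"
    by (simp add: reflp_def)
  show "symp (\<lambda>x y :: real. x - y \<in> \<int>)"
  proof (rule sympI)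
    fix x y :: real
    assume "x - y \<in> \<int>"
    then have "- (x - y) \<in> \<int>" by (rule Ints_minus)
    then show "y - x \<in> \<int>" by simp
  qed
  show "transp (\<lambda>x y :: real. x - y \<in> \<int>)"
  proof (rule transpI)
    fix x y z :: real
    assume "x - y \<in> \<int>" "y - z \<in> \<int>"
    then have "(x - y) + (y - z) \<in> \<int>" by (rule Ints_add)
    then show "x - z \<in> \<int>" by simp
  qed
qed

text \<open>The projection from \<open>real\<close> to \<open>circle\<close> is a local diffeomorphism for the smooth structure of
  the circle, so smoothness can be tested after composing with it.\<close>

definition smooth_hamiltonian :: "('w::t2_space, 'e::euclidean_space) chart set \<Rightarrow> (circle \<Rightarrow> 'w \<Rightarrow> real) \<Rightarrow> bool" where
  "smooth_hamiltonian A H \<longleftrightarrow>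
     (\<forall>c\<in>A. smooth_on (UNIV \<times> cmap c ` cdom c) (\<lambda>(s, x). H (proj_circle s) (cinv c x)))"

definition ham_vfield :: "('w, 'e::euclidean_space) form1 \<Rightarrow> ('w \<Rightarrow> real) \<Rightarrow> ('w, 'e) vfield" where
  "ham_vfield \<theta> h = dual_vfield \<theta> (differential h)"

definition tau :: "('w, 'e::euclidean_space) chart set \<Rightarrow> ('w, 'e) form1 \<Rightarrow> (circle \<Rightarrow> 'w \<Rightarrow> real) \<Rightarrow> circle \<Rightarrow> 'w \<Rightarrow> real" where
  "tau A \<theta> H t p = (let c = chart_at A p in \<theta> c p (ham_vfield \<theta> (H t) c p) + H t p)"

definition Hams :: "('w::t2_space, 'e::euclidean_space) chart set \<Rightarrow> ('w, 'e) form1 \<Rightarrow> (circle \<Rightarrow> 'w \<Rightarrow> real) set" where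
  "Hams A \<theta> = {H. smooth_hamiltonian A H \<and>
     (\<exists>U. open U \<and> boundary A \<subseteq> U \<and> (\<forall>w\<in>U. \<forall>s t. H s w = H t w)) \<and>
     (\<forall>t. \<forall>w\<in>boundary A. H t w = 0) \<and>
     (\<forall>t w. tau A \<theta> H t w > 0)}"

subsection \<open>Lawvere metric categories and the distances\<close>

definition lawvere_metric_category :: "'o set \<Rightarrow> ('o \<Rightarrow> 'o \<Rightarrow> ereal) \<Rightarrow> bool" where
  "lawvere_metric_category Ob hom_fn \<longleftrightarrow>
     (\<forall>x\<in>Ob. \<forall>y\<in>Ob. 0 \<le> hom_fn x y) \<and>
     (\<forall>x\<in>Ob. hom_fn x x = 0) \<and>
     (\<forall>x\<in>Ob. \<forall>y\<in>Ob. \<forall>z\<in>Ob. hom_fn x z \<le> hom_fn x y + hom_fn y z)"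

text \<open>The suprema below may be infinite.\<close>

definition ln_ext :: "ereal \<Rightarrow> ereal" where
  "ln_ext x = (if x \<le> 0 then -\<infinity> else if x = \<infinity> then \<infinity> else ereal (ln (real_of_ereal x)))"

definition hom_Tun :: "('w::t2_space, 'e::euclidean_space) chart set \<Rightarrow> ('w, 'e) form1 \<Rightarrow>
    (circle \<Rightarrow> 'w \<Rightarrow> real) \<Rightarrow> (circle \<Rightarrow> 'w \<Rightarrow> real) \<Rightarrow> ereal" where
  "hom_Tun A \<theta> H G = (INF \<psi>\<in>Symp A \<theta>.
     max (ln_ext (SUP (t, w) \<in> UNIV \<times> Int_mfd A. ereal (H t w / G t (\<psi> w)))) 0)"

definition hom_sym_Tun :: "('w::t2_space, 'e::euclidean_space) chart set \<Rightarrow> ('w, 'e) form1 \<Rightarrow>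
    (circle \<Rightarrow> 'w \<Rightarrow> real) \<Rightarrow> (circle \<Rightarrow> 'w \<Rightarrow> real) \<Rightarrow> ereal" where
  "hom_sym_Tun A \<theta> H G = (INF \<psi>\<in>Symp A \<theta>.
     ln_ext (SUP (t, w) \<in> UNIV \<times> Int_mfd A. ereal (max (H t w / G t (\<psi> w)) (G t (\<psi> w) / H t w))))"

definition d_T :: "('w::t2_space, 'e::euclidean_space) chart set \<Rightarrow> ('w, 'e) form1 \<Rightarrow>
    (circle \<Rightarrow> 'w \<Rightarrow> real) \<Rightarrow> (circle \<Rightarrow> 'w \<Rightarrow> real) \<Rightarrow> ereal" where
  "d_T A \<theta> H G = Inf {ereal (ln C) | C :: real. C > 0 \<and> ln C \<ge> 0 \<and>
     (\<exists>\<phi>\<in>Symp A \<theta>. \<forall>t w. 1 / C * H t w \<le> G t (\<phi> w) \<and> G t (\<phi> w) \<le> C * H t w)}"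

end

theory Submission
  imports Defs
begin

text \<open>The elements of \<open>Symp\<close> form a monoid and map interior to interior, by invariance of domain:
  an open subset of the interior cannot be mapped injectively onto a set touching the boundary
  hyperplane of the half-space. Elements of \<open>Hams\<close> are positive on the interior: at an interior
  minimum of \<open>H\<^sub>t\<close> the differential vanishes, so \<open>\<tau>\<close> equals \<open>H\<close> there and the minimum is positive,
  while the boundary value is 0. Hence
  \<open>H\<^sub>1(w) / H\<^sub>3(\<psi>(\<phi>(w))) = (H\<^sub>1(w) / H\<^sub>2(\<phi>(w))) * (H\<^sub>2(\<phi>(w)) / H\<^sub>3(\<psi>(\<phi>(w))))\<close>
  makes sense on the interior and yields the triangle inequality. For fixed \<open>\<psi>\<close>, the
  Thompson bound with constant \<open>C\<close> is equivalent to both quotients being at most \<open>C\<close>; on the boundary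
  it is trivial, and since the interior is nonempty it forces \<open>C \<ge> 1\<close>.\<close>

subsection \<open>Calculus of smooth maps\<close>

lemma Ck_on_cong:
  assumes "open N" "\<And>x. x \<in> N \<Longrightarrow> f x = g x" "Ck_on k f N"
  shows "Ck_on k g N"
  using assms(2,3)
proof (induction k arbitrary: f g)
  case 0
  then show ?case by (simp cong: continuous_on_cong)
next
  case (Suc k)
  have diff: "f differentiable at x" if "x \<in> N" for x
    using Suc.prems that by simp
  have "g differentiable at x" if "x \<in> N" for x
    using diff[OF that] has_derivative_transform_within_open[OF _ \<open>open N\<close> that, of f] Suc.prems(1)
    by (metis differentiable_def)
  moreover have "Ck_on k (\<lambda>x. frechet_derivative g (at x) v) N" for v
  proof (rule Suc.IH)
    show "frechet_derivative f (at x) v = frechet_derivative g (at x) v" if "x \<in> N" for x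
      using frechet_derivative_transform_within_open[OF diff[OF that] \<open>open N\<close> that] Suc.prems(1)
      by metis
    show "Ck_on k (\<lambda>x. frechet_derivative f (at x) v) N"
      using Suc.prems by simp
  qed
  ultimately show ?case by simp
qed

text \<open>For \<open>k > 0\<close> the definition does not mention continuity of \<open>f\<close>
  itself; it comes from differentiability.\<close>

lemma Ck_on_continuous_on: "Ck_on k f N \<Longrightarrow> continuous_on N f"
  by (cases k) (simp_all add: continuous_at_imp_continuous_on differentiable_imp_continuous_within)

lemma Ck_on_SucD: "Ck_on (Suc k) f N \<Longrightarrow> Ck_on k f N"
proof (induction k arbitrary: f)
  case 0
  then show ?case by (rule Ck_on_continuous_on[of "Suc 0", THEN Ck_on.simps(1)[THEN iffD2]])
next
  case (Suc k)
  from Suc.prems have "\<forall>x\<in>N. f differentiable at x"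
    and "Ck_on (Suc k) (\<lambda>x. frechet_derivative f (at x) v) N" for v
    unfolding Ck_on.simps(2)[of "Suc k"] by blast+
  with Suc.IH show ?case by simp
qed

lemma Ck_on_subset: "Ck_on k f N \<Longrightarrow> M \<subseteq> N \<Longrightarrow> Ck_on k f M"
  by (induction k arbitrary: f) (auto intro: continuous_on_subset)

lemma Ck_on_zero: "Ck_on k (\<lambda>x. 0) N"
  by (induction k) (simp_all add: frechet_derivative_const)

lemma Ck_on_add:
  assumes "open N" "Ck_on k f N" "Ck_on k g N"
  shows "Ck_on k (\<lambda>x. f x + g x) N"
  using assms(2,3)
proof (induction k arbitrary: f g)
  case 0
  then show ?case by (simp add: continuous_on_add)
next
  case (Suc k)
  have "Ck_on k (\<lambda>x. frechet_derivative (\<lambda>x. f x + g x) (at x) v) N" for v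
  proof (rule Ck_on_cong[OF \<open>open N\<close>])
    show "Ck_on k (\<lambda>x. frechet_derivative f (at x) v + frechet_derivative g (at x) v) N"
      using Suc by simp
    show "frechet_derivative f (at x) v + frechet_derivative g (at x) v =
        frechet_derivative (\<lambda>x. f x + g x) (at x) v" if "x \<in> N" for x
    proof -
      have "((\<lambda>x. f x + g x) has_derivative
          (\<lambda>v. frechet_derivative f (at x) v + frechet_derivative g (at x) v)) (at x)"
        using Suc.prems that
        by (intro has_derivative_add) (simp_all add: frechet_derivative_works[symmetric])
      then show ?thesis by (subst frechet_derivative_at[symmetric]) auto
    qed
  qed
  then show ?case using Suc.prems by simp
qed

lemma Ck_on_sum:
  assumes "open N" "\<And>b. b \<in> B \<Longrightarrow> Ck_on k (f b) N"
  shows "Ck_on k (\<lambda>x. \<Sum>b\<in>B. f b x) N"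
  using assms(2)
  by (induction B rule: infinite_finite_induct) (simp_all add: Ck_on_zero Ck_on_add[OF assms(1)])

text \<open>The Leibniz rule turns order \<open>Suc k\<close> into two products of order
  \<open>k\<close>, in which the undifferentiated factor is used only at order \<open>k\<close>.
  \<open>Ck_on_cong\<close> is needed because the product rule identifies the derivative only at
  points of \<open>N\<close>.\<close>

lemma Ck_on_bilinear:
  assumes P: "bounded_bilinear P" and "open N" "Ck_on k f N" "Ck_on k g N"
  shows "Ck_on k (\<lambda>x. P (f x) (g x)) N"
  using assms(3,4)
proof (induction k arbitrary: f g)
  case 0
  then show ?case using bounded_bilinear.continuous_on[OF P] by simp
next
  case (Suc k)
  have D: "((\<lambda>x. P (f x) (g x)) has_derivative
      (\<lambda>v. P (f x) (frechet_derivative g (at x) v) + P (frechet_derivative f (at x) v) (g x))) (at x)"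
    if "x \<in> N" for x
    using Suc.prems that
    by (intro bounded_bilinear.FDERIV[OF P]) (simp_all add: frechet_derivative_works[symmetric])
  have "Ck_on k (\<lambda>x. frechet_derivative (\<lambda>x. P (f x) (g x)) (at x) v) N" for v
  proof (rule Ck_on_cong[OF \<open>open N\<close>])
    show "Ck_on k (\<lambda>x. P (f x) (frechet_derivative g (at x) v) + P (frechet_derivative f (at x) v) (g x)) N"
      using Suc.prems by (intro Ck_on_add[OF \<open>open N\<close>] Suc.IH) (auto dest: Ck_on_SucD simp del: Ck_on.simps, simp_all)
    show "P (f x) (frechet_derivative g (at x) v) + P (frechet_derivative f (at x) v) (g x) =
        frechet_derivative (\<lambda>x. P (f x) (g x)) (at x) v" if "x \<in> N" for x
      by (subst frechet_derivative_at[OF D[OF that], symmetric]) (rule refl)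
  qed
  with D show ?case by (auto simp: differentiable_def)
qed

text \<open>By the chain rule the derivative is \<open>g\<close> differentiated at
  \<open>f x\<close> in a direction that moves with \<open>x\<close>, whereas \<open>Ck_on\<close>
  speaks of fixed directions only. Expanding the direction in \<open>Basis\<close> leaves products
  of its components with derivatives of \<open>g\<close> along fixed vectors. The induction
  therefore varies \<open>g\<close> and keeps \<open>f\<close>.\<close>

lemma Ck_on_compose:
  fixes f :: "'a::euclidean_space \<Rightarrow> 'b::euclidean_space" and g :: "'b \<Rightarrow> 'c::euclidean_space"
  assumes "open N" "open M" "f ` N \<subseteq> M" and f: "Ck_on k f N" and g: "Ck_on k g M"
  shows "Ck_on k (g \<circ> f) N"
  using f g
proof (induction k arbitrary: g)
  case 0
  then show ?case using assms(3) continuous_on_compose[of N f g] continuous_on_subset[of M g] by simp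
next
  case (Suc k)
  let ?Df = "\<lambda>x. frechet_derivative f (at x)" and ?Dg = "\<lambda>x. frechet_derivative g (at x)"
  have g': "(g has_derivative ?Dg (f x)) (at (f x))" if "x \<in> N" for x
  proof -
    have "g differentiable at (f x)" using Suc.prems(2) that assms(3) by auto
    then show ?thesis by (simp add: frechet_derivative_works)
  qed
  have D: "((g \<circ> f) has_derivative ?Dg (f x) \<circ> ?Df x) (at x)" if "x \<in> N" for x
  proof (intro diff_chain_at g' that)
    have "f differentiable at x" using Suc.prems(1) that by simp
    then show "(f has_derivative ?Df x) (at x)" by (simp add: frechet_derivative_works)
  qed
  have "Ck_on k (\<lambda>x. frechet_derivative (g \<circ> f) (at x) v) N" for v
  proof (rule Ck_on_cong[OF \<open>open N\<close>])
    have P: "bounded_bilinear (\<lambda>y (z::'c). (y \<bullet> b) *\<^sub>R z)" for b :: 'b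
      using bounded_bilinear.comp1[OF bounded_bilinear_scaleR bounded_linear_inner_left] .
    have Df: "Ck_on k (\<lambda>x. ?Df x v) N" using Suc.prems by simp
    have Dg: "Ck_on k (\<lambda>x. ?Dg (f x) b) N" for b
    proof -
      have "Ck_on k (\<lambda>y. ?Dg y b) M" using Suc.prems(2) by simp
      from Suc.IH[OF Ck_on_SucD[OF Suc.prems(1)] this] show ?thesis by (simp add: o_def)
    qed
    show "Ck_on k (\<lambda>x. \<Sum>b\<in>Basis. (?Df x v \<bullet> b) *\<^sub>R ?Dg (f x) b) N"
      by (rule Ck_on_sum[OF \<open>open N\<close>], rule Ck_on_bilinear[OF P \<open>open N\<close> Df Dg])
    show "(\<Sum>b\<in>Basis. (?Df x v \<bullet> b) *\<^sub>R ?Dg (f x) b) = frechet_derivative (g \<circ> f) (at x) v"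
      if "x \<in> N" for x
    proof -
      have lin: "linear (?Dg (f x))"
        using g'[OF that] by (rule has_derivative_linear)
      have "frechet_derivative (g \<circ> f) (at x) v = ?Dg (f x) (?Df x v)"
        by (subst frechet_derivative_at[OF D[OF that], symmetric]) simp
      also have "\<dots> = ?Dg (f x) (\<Sum>b\<in>Basis. (?Df x v \<bullet> b) *\<^sub>R b)"
        by (simp add: euclidean_representation)
      also have "\<dots> = (\<Sum>b\<in>Basis. (?Df x v \<bullet> b) *\<^sub>R ?Dg (f x) b)"
        by (simp add: linear_sum[OF lin] linear_cmul[OF lin])
      finally show ?thesis by simp
    qed
  qed
  moreover have "(g \<circ> f) differentiable at x" if "x \<in> N" for x
    using D[OF that] unfolding differentiable_def by blast
  ultimately show ?case unfolding Ck_on.simps by blast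
qed

section \<open>Smooth maps on arbitrary subsets\<close>

lemma smooth_on_compose:
  assumes f: "smooth_on S f" and g: "smooth_on T g" and "f ` S \<subseteq> T"
  shows "smooth_on S (g \<circ> f)"
  unfolding smooth_on_def
proof
  fix x assume "x \<in> S"
  with f obtain N f0 where N: "open N" "x \<in> N" "\<And>k. Ck_on k f0 N" "\<And>y. y \<in> N \<inter> S \<Longrightarrow> f0 y = f y"
    unfolding smooth_on_def by metis
  have "f x \<in> T" using \<open>x \<in> S\<close> assms(3) by auto
  with g obtain M g0 where M: "open M" "f x \<in> M" "\<And>k. Ck_on k g0 M" "\<And>y. y \<in> M \<inter> T \<Longrightarrow> g0 y = g y"
    unfolding smooth_on_def by metis
  \<comment> \<open>Off \<open>S\<close> the extension \<open>f0\<close> may leave \<open>M\<close>,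
    so its domain is cut down to the preimage of \<open>M\<close>.\<close>
  let ?N = "N \<inter> f0 -` M"
  have "open ?N"
    using N(1) M(1) Ck_on_continuous_on[OF N(3)] by (metis Int_commute continuous_on_open_vimage)
  moreover have "x \<in> ?N" using N(2,4) M(2) \<open>x \<in> S\<close> by auto
  moreover have "Ck_on k (g0 \<circ> f0) ?N" for k
    using \<open>open ?N\<close> M(1,3) N(3) by (intro Ck_on_compose[of ?N M]) (auto intro: Ck_on_subset)
  moreover have "(g0 \<circ> f0) y = (g \<circ> f) y" if "y \<in> ?N \<inter> S" for y
    using that N(4)[of y] M(4)[of "f y"] assms(3) by auto
  ultimately show "\<exists>N h. open N \<and> x \<in> N \<and> (\<forall>k. Ck_on k h N) \<and> (\<forall>y\<in>N \<inter> S. h y = (g \<circ> f) y)"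
    by blast
qed

lemma smooth_on_cong_subset:
  assumes "smooth_on S f" "T \<subseteq> S" "\<And>x. x \<in> T \<Longrightarrow> f x = g x"
  shows "smooth_on T g"
  unfolding smooth_on_def
proof
  fix x assume "x \<in> T"
  with assms(1,2) obtain N h where "open N" "x \<in> N" "\<forall>k. Ck_on k h N" "\<forall>y\<in>N \<inter> S. h y = f y"
    unfolding smooth_on_def by (metis subsetD)
  with assms(2,3) show "\<exists>N h. open N \<and> x \<in> N \<and> (\<forall>k. Ck_on k h N) \<and> (\<forall>y\<in>N \<inter> T. h y = g y)"
    by (intro exI[of _ N] exI[of _ h]) auto
qed

lemma smooth_on_local:
  assumes "\<And>x. x \<in> S \<Longrightarrow> \<exists>U. open U \<and> x \<in> U \<and> smooth_on (S \<inter> U) f"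
  shows "smooth_on S f"
  unfolding smooth_on_def
proof
  fix x assume "x \<in> S"
  with assms obtain U where U: "open U" "x \<in> U" "smooth_on (S \<inter> U) f" by blast
  with \<open>x \<in> S\<close> obtain N g where N: "open N" "x \<in> N" "\<forall>k. Ck_on k g N" "\<forall>y\<in>N \<inter> (S \<inter> U). g y = f y"
    unfolding smooth_on_def by (metis IntI)
  have "Ck_on k g (N \<inter> U)" for k using N(3) Ck_on_subset by blast
  then show "\<exists>N g. open N \<and> x \<in> N \<and> (\<forall>k. Ck_on k g N) \<and> (\<forall>y\<in>N \<inter> S. g y = f y)"
    using U N by (intro exI[of _ "N \<inter> U"] exI[of _ g]) auto
qed

section \<open>Derivatives within the half-space\<close>

lemma smooth_on_imp_differentiable_within:
  assumes "smooth_on S f" "x \<in> S"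
  shows "f differentiable (at x within S)"
proof -
  from assms obtain N g where N: "open N" "x \<in> N" "\<And>k. Ck_on k g N" "\<And>y. y \<in> N \<inter> S \<Longrightarrow> g y = f y"
    unfolding smooth_on_def by metis
  from N(3)[of 1] N(2) have "g differentiable (at x within S)"
    by (auto intro: differentiable_at_withinI)
  then obtain g' where "(g has_derivative g') (at x within S)"
    by (auto simp: differentiable_def)
  moreover obtain e where "e > 0" "ball x e \<subseteq> N" using N openE by blast
  ultimately have "(f has_derivative g') (at x within S)"
    using N(4) assms(2) by (intro has_derivative_transform_within[of g g' x S e f]) (auto simp: dist_commute subset_iff)
  then show ?thesis by (auto simp: differentiable_def)
qed

text \<open>A relatively open set agrees with the half-space near each of its points. This moves
  derivatives between chart images and the fixed domain used by \<open>Dh\<close>.\<close>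

lemma at_within_half_space:
  assumes "openin (top_of_set half_space) S" "x \<in> S"
  shows "at x within half_space = at x within S"
proof -
  from assms(1) obtain U where "open U" "S = half_space \<inter> U" by (auto simp: openin_open)
  with assms(2) show ?thesis by (intro at_within_nhd[of x U]) auto
qed

lemma half_space_derivative_unique:
  fixes f :: "'e::euclidean_space \<times> real \<Rightarrow> 'b::euclidean_space"
  assumes "(f has_derivative f') (at x within half_space)" "x \<in> half_space"
  shows "Dh f x = f'"
proof -
  \<comment> \<open>A small positive step along any basis vector never lowers the last coordinate,
    so even at boundary points the half-space contains enough directions to determine the
    derivative.\<close>
  have "\<exists>d. 0 < \<bar>d\<bar> \<and> \<bar>d\<bar> < e \<and> x + d *\<^sub>R i \<in> half_space"
    if "i \<in> Basis" "e > 0" for i :: "'e \<times> real" and e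
    using that assms(2) by (intro exI[of _ "e/2"]) (auto simp: half_space_def Basis_prod_def)
  then show ?thesis
    using assms by (intro frechet_derivative_unique_within[of f _ x half_space])
      (auto simp: frechet_derivative_works[symmetric] differentiable_def)
qed

lemma smooth_on_half_space_derivative:
  assumes "openin (top_of_set half_space) S" "smooth_on S f" "x \<in> S"
  shows "(f has_derivative Dh f x) (at x within half_space)"
  using smooth_on_imp_differentiable_within[OF assms(2,3)]
  unfolding at_within_half_space[OF assms(1,3)] frechet_derivative_works .

text \<open>Positive last coordinate makes the one-sided derivative a full derivative, so Fermat's
  criterion applies. At a boundary point the inward derivative could be positive.\<close>

lemma derivative_eq_0_at_interior_min:
  fixes f :: "'e::euclidean_space \<times> real \<Rightarrow> real"
  assumes f: "(f has_derivative D) (at x within half_space)" and "0 < snd x"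
    and min: "\<And>y. y \<in> S \<Longrightarrow> f x \<le> f y" and S: "openin (top_of_set half_space) S" "x \<in> S"
  shows "D = (\<lambda>v. 0)"
proof (rule has_derivative_local_min)
  have "open {x :: 'e \<times> real. 0 < snd x}"
    by (intro open_Collect_less continuous_intros)
  moreover have "{x :: 'e \<times> real. 0 < snd x} \<subseteq> half_space" by (auto simp: half_space_def)
  ultimately have int: "x \<in> interior half_space" using \<open>0 < snd x\<close> by (blast intro: interiorI)
  show "(f has_derivative D) (at x)" using f unfolding at_within_interior[OF int] .
  have "eventually (\<lambda>y. y \<in> S) (at x within half_space)"
    unfolding at_within_half_space[OF S] by (simp add: eventually_at_filter)
  then show "eventually (\<lambda>y. f x \<le> f y) (at x)"
    unfolding at_within_interior[OF int] using min by (rule eventually_mono)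
qed

subsection \<open>Charts, boundary and symplectomorphisms\<close>

context
  fixes A :: "('w::t2_space, 'e::euclidean_space) chart set"
  assumes atlas: "smooth_atlas A"
begin

lemma chart_around: "\<exists>c\<in>A. p \<in> cdom c"
  using atlas unfolding smooth_atlas_def by blast

lemma chart_at: "chart_at A p \<in> A" "p \<in> cdom (chart_at A p)"
  using someI_ex[of "\<lambda>c. c \<in> A \<and> p \<in> cdom c"] chart_around[of p] unfolding chart_at_def by blast+

lemma chart_homeomorphism:
  "c \<in> A \<Longrightarrow> homeomorphism (cdom c) (cmap c ` cdom c) (cmap c) (cinv c)"
  and open_cdom: "c \<in> A \<Longrightarrow> open (cdom c)"
  and openin_cmap: "c \<in> A \<Longrightarrow> openin (top_of_set half_space) (cmap c ` cdom c)"
  using atlas unfolding smooth_atlas_def by blast+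

lemma cinv_cmap: "c \<in> A \<Longrightarrow> p \<in> cdom c \<Longrightarrow> cinv c (cmap c p) = p"
  using homeomorphism_apply1[OF chart_homeomorphism] .

lemma snd_cmap_nonneg: "c \<in> A \<Longrightarrow> p \<in> cdom c \<Longrightarrow> 0 \<le> snd (cmap c p)"
  using openin_subset[OF openin_cmap, of c] by (auto simp: half_space_def)

lemma openin_cmap_Int:
  assumes "c \<in> A" "open V"
  shows "openin (top_of_set half_space) (cmap c ` (cdom c \<inter> V))"
proof -
  have "openin (top_of_set (cdom c)) (cdom c \<inter> V)" using assms(2) by auto
  from homeomorphism_imp_open_map[OF chart_homeomorphism[OF assms(1)] this]
  show ?thesis using openin_cmap[OF assms(1)] openin_trans by blast
qed

lemma transition_smooth:
  "c \<in> A \<Longrightarrow> d \<in> A \<Longrightarrow> smooth_on (cmap c ` (cdom c \<inter> cdom d)) (cmap d \<circ> cinv c)"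
  using atlas unfolding smooth_atlas_def by blast

section \<open>Invariance of interior and boundary\<close>

lemma injective_map_interior:
  assumes \<psi>: "continuous_on UNIV \<psi>" "inj \<psi>" and c: "c \<in> A" "p \<in> cdom c" "0 < snd (cmap c p)"
    and d: "d \<in> A" "\<psi> p \<in> cdom d"
  shows "0 < snd (cmap d (\<psi> p))"
proof -
  define V where "V = cdom c \<inter> \<psi> -` cdom d"
  define S where "S = cmap c ` V \<inter> {x. 0 < snd x}"
  define f where "f = cmap d \<circ> \<psi> \<circ> cinv c"
  have "open (\<psi> -` cdom d)"
    using \<psi>(1) open_cdom[OF d(1)] by (simp add: continuous_on_open_vimage)
  then obtain U where U: "open U" "cmap c ` V = half_space \<inter> U"
    using openin_cmap_Int[OF c(1), of "\<psi> -` cdom d"] unfolding V_def openin_open by blast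
  \<comment> \<open>Removing the hyperplane turns a relatively open set into one that is open in the
    whole space, as invariance of domain requires.\<close>
  have "S = U \<inter> {x. 0 < snd x}"
    using U(2) unfolding S_def by (auto simp: half_space_def)
  moreover have "open {x :: 'e \<times> real. 0 < snd x}"
    by (intro open_Collect_less continuous_intros)
  ultimately have "open S" using U(1) by auto
  moreover have "continuous_on S f"
  proof -
    have 1: "continuous_on S (cinv c)"
      using homeomorphism_cont2[OF chart_homeomorphism[OF c(1)]]
      by (rule continuous_on_subset) (auto simp: S_def V_def)
    have 2: "continuous_on (cinv c ` S) \<psi>" using \<psi>(1) continuous_on_subset by blast
    have 3: "continuous_on (\<psi> ` cinv c ` S) (cmap d)"
      using homeomorphism_cont1[OF chart_homeomorphism[OF d(1)]]
      by (rule continuous_on_subset) (auto simp: S_def V_def cinv_cmap[OF c(1)])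
    show ?thesis
      unfolding f_def using continuous_on_compose[OF 1 continuous_on_compose[OF 2 3]] by (simp add: o_assoc)
  qed
  moreover have "inj_on f S"
  proof (rule inj_onI)
    fix x y assume "x \<in> S" "y \<in> S" "f x = f y"
    then obtain q r where q: "q \<in> V" "x = cmap c q" and r: "r \<in> V" "y = cmap c r"
      unfolding S_def by auto
    with \<open>f x = f y\<close> have "cmap d (\<psi> q) = cmap d (\<psi> r)"
      by (simp add: f_def V_def cinv_cmap[OF c(1)])
    then have "cinv d (cmap d (\<psi> q)) = cinv d (cmap d (\<psi> r))" by simp
    then have "\<psi> q = \<psi> r" using q r by (simp add: V_def cinv_cmap[OF d(1)])
    with \<psi>(2) q r show "x = y" by (simp add: inj_eq)
  qed
  ultimately have "open (f ` S)" by (intro invariance_of_domain)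
  moreover have "cmap d (\<psi> p) \<in> f ` S"
    using c d by (intro image_eqI[of _ _ "cmap c p"]) (auto simp: f_def S_def V_def cinv_cmap)
  ultimately obtain e where e: "e > 0" "cball (cmap d (\<psi> p)) e \<subseteq> f ` S"
    using open_contains_cball by blast
  \<comment> \<open>The image is open in the whole space yet lies in the half-space, so moving down
    by \<open>e\<close> keeps the last coordinate nonnegative.\<close>
  have "cmap d (\<psi> p) - (0, e) \<in> cball (cmap d (\<psi> p)) e"
    using e(1) by (simp add: dist_norm norm_Pair)
  with e(2) obtain x where x: "x \<in> S" "cmap d (\<psi> p) - (0, e) = f x" by blast
  then have "0 \<le> snd (f x)"
    by (auto simp: S_def V_def f_def cinv_cmap[OF c(1)] snd_cmap_nonneg[OF d(1)])
  with x(2) have "0 \<le> snd (cmap d (\<psi> p)) - e" by (metis snd_diff snd_conv)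
  with e(1) show ?thesis by simp
qed

text \<open>Membership in \<open>boundary\<close> is witnessed by a single chart. Independence of
  the chart is \<open>injective_map_interior\<close> for the identity, read between two
  charts.\<close>

lemma boundary_iff:
  assumes "c \<in> A" "p \<in> cdom c"
  shows "p \<in> boundary A \<longleftrightarrow> snd (cmap c p) = 0"
proof
  assume "p \<in> boundary A"
  then obtain d where "d \<in> A" "p \<in> cdom d" "snd (cmap d p) = 0" unfolding boundary_def by blast
  with injective_map_interior[of id c p d] snd_cmap_nonneg[OF assms] assms
  show "snd (cmap c p) = 0" by fastforce
qed (use assms in \<open>auto simp: boundary_def\<close>)

lemma interior_iff: "c \<in> A \<Longrightarrow> p \<in> cdom c \<Longrightarrow> p \<notin> boundary A \<longleftrightarrow> 0 < snd (cmap c p)"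
  using boundary_iff[of c p] snd_cmap_nonneg[of c p] by auto

lemma injective_map_preserves_interior:
  assumes "continuous_on UNIV \<psi>" "inj \<psi>" "p \<notin> boundary A"
  shows "\<psi> p \<notin> boundary A"
proof -
  obtain c d where "c \<in> A" "p \<in> cdom c" "d \<in> A" "\<psi> p \<in> cdom d" using chart_around by metis
  then show ?thesis using assms injective_map_interior interior_iff by simp
qed

lemma diffeo_boundary_iff:
  assumes "diffeo A \<psi>"
  shows "\<psi> p \<in> boundary A \<longleftrightarrow> p \<in> boundary A"
  using assms injective_map_preserves_interior[of \<psi> p] injective_map_preserves_interior[of "inv \<psi>" "\<psi> p"]
  unfolding diffeo_def smooth_map_def by (metis bij_imp_bij_inv bij_is_inj inv_f_f)

text \<open>Any point, even one on the boundary, can be pushed inward along the last coordinate of a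
  chart.\<close>

lemma interior_nonempty: "Int_mfd A \<noteq> {}"
proof -
  fix p :: 'w
  obtain c where c: "c \<in> A" "p \<in> cdom c" using chart_around by blast
  obtain U where U: "open U" "cmap c ` cdom c = half_space \<inter> U"
    using openin_cmap[OF c(1)] by (auto simp: openin_open)
  have "cmap c p \<in> U" using U(2) c(2) by blast
  then obtain e where e: "e > 0" "cball (cmap c p) e \<subseteq> U"
    using U(1) open_contains_cball by blast
  have "cmap c p + (0, e) \<in> cball (cmap c p) e"
    using e(1) by (simp add: dist_norm norm_Pair)
  moreover have pos: "0 < snd (cmap c p + (0, e))" using e(1) snd_cmap_nonneg[OF c] by simp
  ultimately have "cmap c p + (0, e) \<in> cmap c ` cdom c"
    using U(2) e(2) by (auto simp: half_space_def)
  then obtain q where "q \<in> cdom c" "cmap c q = cmap c p + (0, e)" by (metis imageE)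
  with pos interior_iff[OF c(1), of q] show ?thesis by auto
qed

section \<open>Smooth self-maps and the monoid \<open>Symp\<close>\<close>

lemma smooth_map_id: "smooth_map A id"
  using transition_smooth by (auto simp: smooth_map_def)

lemma smooth_map_chart:
  assumes "smooth_map A \<psi>" "c \<in> A" "d \<in> A"
  shows "openin (top_of_set half_space) (cmap c ` (cdom c \<inter> \<psi> -` cdom d))"
    and "smooth_on (cmap c ` (cdom c \<inter> \<psi> -` cdom d)) (cmap d \<circ> \<psi> \<circ> cinv c)"
  using assms openin_cmap_Int[OF assms(2)] open_cdom[OF assms(3)]
  by (simp_all add: smooth_map_def continuous_on_open_vimage)

text \<open>The image under \<open>\<phi>\<close> need not lie in one chart, so the claim is
  localised: near each point one intermediate chart \<open>d\<close> suffices.\<close>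

lemma smooth_map_compose:
  assumes \<phi>: "smooth_map A \<phi>" and \<psi>: "smooth_map A \<psi>"
  shows "smooth_map A (\<psi> \<circ> \<phi>)"
  unfolding smooth_map_def
proof (intro conjI ballI)
  show "continuous_on UNIV (\<psi> \<circ> \<phi>)"
    using \<phi> \<psi> unfolding smooth_map_def
    by (metis continuous_on_compose continuous_on_subset subset_UNIV)
  fix c e assume ce: "c \<in> A" "e \<in> A"
  let ?S = "cmap c ` (cdom c \<inter> (\<psi> \<circ> \<phi>) -` cdom e)"
  show "smooth_on ?S (cmap e \<circ> (\<psi> \<circ> \<phi>) \<circ> cinv c)"
  proof (rule smooth_on_local)
    fix x assume "x \<in> ?S"
    then obtain p where p: "p \<in> cdom c" "\<psi> (\<phi> p) \<in> cdom e" "x = cmap c p" by auto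
    obtain d where d: "d \<in> A" "\<phi> p \<in> cdom d" using chart_around by blast
    let ?S1 = "cmap c ` (cdom c \<inter> \<phi> -` cdom d)" and ?S2 = "cmap d ` (cdom d \<inter> \<psi> -` cdom e)"
    obtain U where U: "open U" "?S1 = half_space \<inter> U"
      using smooth_map_chart(1)[OF \<phi> ce(1) d(1)] by (auto simp: openin_open)
    have sub: "?S \<inter> U \<subseteq> ?S1"
      using U(2) snd_cmap_nonneg[OF ce(1)] by (auto simp: half_space_def)
    \<comment> \<open>The conditions on \<open>\<phi>\<close> and on
      \<open>\<psi> \<circ> \<phi>\<close> come with separate preimages of \<open>y\<close>;
      injectivity of the chart makes them the same point.\<close>
    have chart: "\<exists>q. y = cmap c q \<and> q \<in> cdom c \<and> \<phi> q \<in> cdom d \<and> \<psi> (\<phi> q) \<in> cdom e" if "y \<in> ?S \<inter> U" for y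
    proof -
      have "y \<in> ?S1" using that sub by blast
      then obtain r where r: "y = cmap c r" "r \<in> cdom c" "\<phi> r \<in> cdom d" by auto
      from that obtain q where q: "y = cmap c q" "q \<in> cdom c" "\<psi> (\<phi> q) \<in> cdom e" by auto
      have "q = r" using q r cinv_cmap[OF ce(1), of q] cinv_cmap[OF ce(1), of r] by simp
      with q r show ?thesis by metis
    qed
    have "smooth_on (?S \<inter> U) (cmap d \<circ> \<phi> \<circ> cinv c)"
      using smooth_on_cong_subset[OF smooth_map_chart(2)[OF \<phi> ce(1) d(1)] sub] by blast
    moreover have "(cmap d \<circ> \<phi> \<circ> cinv c) ` (?S \<inter> U) \<subseteq> ?S2"
    proof (rule image_subsetI)
      fix y assume "y \<in> ?S \<inter> U"
      from chart[OF this] obtain q where q: "y = cmap c q" "q \<in> cdom c" "\<phi> q \<in> cdom d" "\<psi> (\<phi> q) \<in> cdom e"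
        by metis
      then have "(cmap d \<circ> \<phi> \<circ> cinv c) y = cmap d (\<phi> q)" by (simp add: cinv_cmap[OF ce(1)])
      with q show "(cmap d \<circ> \<phi> \<circ> cinv c) y \<in> ?S2" by simp
    qed
    ultimately have "smooth_on (?S \<inter> U) ((cmap e \<circ> \<psi> \<circ> cinv d) \<circ> (cmap d \<circ> \<phi> \<circ> cinv c))"
      using smooth_on_compose smooth_map_chart(2)[OF \<psi> d(1) ce(2)] by blast
    then have "smooth_on (?S \<inter> U) (cmap e \<circ> (\<psi> \<circ> \<phi>) \<circ> cinv c)"
    proof (rule smooth_on_cong_subset[OF _ order_refl])
      fix y assume "y \<in> ?S \<inter> U"
      from chart[OF this] obtain q where "y = cmap c q" "q \<in> cdom c" "\<phi> q \<in> cdom d" "\<psi> (\<phi> q) \<in> cdom e"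
        by metis
      then show "((cmap e \<circ> \<psi> \<circ> cinv d) \<circ> (cmap d \<circ> \<phi> \<circ> cinv c)) y = (cmap e \<circ> (\<psi> \<circ> \<phi>) \<circ> cinv c) y"
        by (simp add: cinv_cmap ce d)
    qed
    moreover have "x \<in> U" using U(2) p d by auto
    ultimately show "\<exists>U. open U \<and> x \<in> U \<and> smooth_on (?S \<inter> U) (cmap e \<circ> (\<psi> \<circ> \<phi>) \<circ> cinv c)"
      using U(1) by blast
  qed
qed

lemma diffeo_compose:
  assumes "diffeo A \<phi>" "diffeo A \<psi>"
  shows "diffeo A (\<psi> \<circ> \<phi>)"
  using assms unfolding diffeo_def by (simp add: bij_comp smooth_map_compose o_inv_distrib)

lemma derivative_compose_charts:
  assumes \<phi>: "smooth_map A \<phi>" and \<psi>: "smooth_map A \<psi>" and "c \<in> A" "d \<in> A" "e \<in> A"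
    and p: "p \<in> cdom c" "\<phi> p \<in> cdom d" "\<psi> (\<phi> p) \<in> cdom e"
  shows "Dh (cmap e \<circ> (\<psi> \<circ> \<phi>) \<circ> cinv c) (cmap c p) v =
    Dh (cmap e \<circ> \<psi> \<circ> cinv d) (cmap d (\<phi> p)) (Dh (cmap d \<circ> \<phi> \<circ> cinv c) (cmap c p) v)"
proof -
  define f where "f = cmap d \<circ> \<phi> \<circ> cinv c"
  define g where "g = cmap e \<circ> \<psi> \<circ> cinv d"
  define S where "S = cmap c ` (cdom c \<inter> \<phi> -` cdom d)"
  have x: "cmap c p \<in> S" "cmap c p \<in> half_space"
    using p snd_cmap_nonneg[OF \<open>c \<in> A\<close>] by (auto simp: S_def half_space_def)
  have S: "openin (top_of_set half_space) S"
    unfolding S_def using smooth_map_chart(1) assms by blast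
  define f' where "f' = Dh f (cmap c p)"
  have "smooth_on S f"
    using smooth_map_chart(2)[OF \<phi> \<open>c \<in> A\<close> \<open>d \<in> A\<close>] by (simp add: S_def f_def)
  from smooth_on_half_space_derivative[OF S this x(1)]
  have f: "(f has_derivative f') (at (cmap c p) within S)"
    unfolding f'_def[symmetric] unfolding at_within_half_space[OF S x(1)] .
  have fp: "f (cmap c p) = cmap d (\<phi> p)" by (simp add: f_def cinv_cmap \<open>c \<in> A\<close> p)
  have "(g has_derivative Dh g (cmap d (\<phi> p))) (at (cmap d (\<phi> p)) within half_space)"
    unfolding g_def using smooth_map_chart[OF \<psi> \<open>d \<in> A\<close> \<open>e \<in> A\<close>] p
    by (intro smooth_on_half_space_derivative) auto
  moreover have "f ` S \<subseteq> half_space"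
    using snd_cmap_nonneg[OF \<open>d \<in> A\<close>] by (auto simp: f_def S_def half_space_def cinv_cmap \<open>c \<in> A\<close>)
  ultimately have "(g has_derivative Dh g (cmap d (\<phi> p))) (at (f (cmap c p)) within f ` S)"
    unfolding fp by (rule has_derivative_subset)
  from diff_chain_within[OF f this]
  have "(g \<circ> f has_derivative Dh g (cmap d (\<phi> p)) \<circ> f') (at (cmap c p) within S)" .
  then have "(cmap e \<circ> (\<psi> \<circ> \<phi>) \<circ> cinv c has_derivative Dh g (cmap d (\<phi> p)) \<circ> f')
      (at (cmap c p) within S)"
    by (rule has_derivative_transform[OF x(1), rotated])
      (auto simp: f_def g_def S_def cinv_cmap \<open>c \<in> A\<close> \<open>d \<in> A\<close>)
  then have "Dh (cmap e \<circ> (\<psi> \<circ> \<phi>) \<circ> cinv c) (cmap c p) = Dh g (cmap d (\<phi> p)) \<circ> f'"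
    unfolding at_within_half_space[OF S x(1), symmetric] by (rule half_space_derivative_unique[OF _ x(2)])
  then show ?thesis by (simp add: f'_def f_def g_def)
qed

lemma Symp_compose:
  assumes \<phi>: "\<phi> \<in> Symp A \<theta>" and \<psi>: "\<psi> \<in> Symp A \<theta>"
  shows "\<psi> \<circ> \<phi> \<in> Symp A \<theta>"
proof -
  have sm: "smooth_map A \<phi>" "smooth_map A \<psi>"
    using assms unfolding Symp_def diffeo_def by auto
  have "pullback A (\<psi> \<circ> \<phi>) \<theta> c p v = \<theta> c p v" if c: "c \<in> A" "p \<in> cdom c" for c p v
  proof -
    \<comment> \<open>These are exactly the charts that \<open>pullback\<close> selects, so the
      chain rule splits the pullback along the composite into two successive pullbacks.\<close>
    let ?d = "chart_at A (\<phi> p)" and ?e = "chart_at A (\<psi> (\<phi> p))"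
    let ?v = "Dh (cmap ?d \<circ> \<phi> \<circ> cinv c) (cmap c p) v"
    have "pullback A (\<psi> \<circ> \<phi>) \<theta> c p v = \<theta> ?e (\<psi> (\<phi> p)) (Dh (cmap ?e \<circ> (\<psi> \<circ> \<phi>) \<circ> cinv c) (cmap c p) v)"
      by (simp add: pullback_def Let_def)
    also have "\<dots> = pullback A \<psi> \<theta> ?d (\<phi> p) ?v"
      by (simp only: derivative_compose_charts[OF sm c(1) chart_at(1) chart_at(1) c(2) chart_at(2) chart_at(2)])
        (simp add: pullback_def Let_def)
    also have "\<dots> = \<theta> ?d (\<phi> p) ?v"
      using \<psi> chart_at[of "\<phi> p"] by (simp add: Symp_def)
    also have "\<dots> = pullback A \<phi> \<theta> c p v"
      by (simp add: pullback_def Let_def)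
    also have "\<dots> = \<theta> c p v"
      using \<phi> c by (simp add: Symp_def)
    finally show ?thesis .
  qed
  moreover have "diffeo A (\<psi> \<circ> \<phi>)" using assms diffeo_compose by (simp add: Symp_def)
  ultimately show ?thesis by (auto simp: Symp_def)
qed

text \<open>\<open>pullback\<close> evaluates in the chart chosen by \<open>chart_at\<close>, so
  even for the identity the transformation law of 1-forms is what returns the value in
  \<open>c\<close>.\<close>

lemma Symp_id:
  assumes "one_form A \<theta>"
  shows "id \<in> Symp A \<theta>"
proof -
  have "pullback A id \<theta> c p v = \<theta> c p v" if "c \<in> A" "p \<in> cdom c" for c p v
  proof -
    let ?d = "chart_at A p"
    have "\<theta> c p v = \<theta> ?d p (Dh (cmap ?d \<circ> cinv c) (cmap c p) v)"
      using assms that chart_at[of p] unfolding one_form_def by blast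
    then show ?thesis by (simp add: pullback_def Let_def)
  qed
  moreover have "diffeo A id" using smooth_map_id by (simp add: diffeo_def)
  ultimately show ?thesis by (auto simp: Symp_def)
qed

section \<open>Hamiltonians in charts\<close>

lemma smooth_hamiltonian_slice_differentiable:
  assumes "smooth_hamiltonian A H" "c \<in> A" "p \<in> cdom c"
  shows "(H t \<circ> cinv c) differentiable (at (cmap c p) within cmap c ` cdom c)"
proof -
  let ?S = "cmap c ` cdom c"
  \<comment> \<open>A lift \<open>s\<close> of \<open>t\<close> to the line exhibits the slice as
    the joint function composed with the affine inclusion of \<open>x\<close> as
    \<open>(s, x)\<close>.\<close>
  obtain s where s: "t = proj_circle s" using circle.abs_induct[of "\<lambda>t. \<exists>s. t = proj_circle s"] by blast
  have "(\<lambda>(s, x). H (proj_circle s) (cinv c x)) differentiable (at (s, cmap c p) within UNIV \<times> ?S)"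
    using assms by (intro smooth_on_imp_differentiable_within) (auto simp: smooth_hamiltonian_def)
  then obtain D where
    D: "((\<lambda>(s, x). H (proj_circle s) (cinv c x)) has_derivative D) (at (s, cmap c p) within UNIV \<times> ?S)"
    by (auto simp: differentiable_def)
  have "((\<lambda>x. (s, x)) has_derivative (\<lambda>x. (0, x))) (at (cmap c p) within ?S)"
    by (auto intro!: derivative_eq_intros)
  from diff_chain_within[OF this has_derivative_subset[OF D]]
  have "((\<lambda>(s, x). H (proj_circle s) (cinv c x)) \<circ> (\<lambda>x. (s, x)) has_derivative D \<circ> (\<lambda>x. (0, x)))
      (at (cmap c p) within ?S)" by auto
  then show ?thesis by (auto simp: differentiable_def o_def s)
qed

lemma smooth_hamiltonian_continuous:
  assumes "smooth_hamiltonian A H"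
  shows "continuous_on UNIV (H t)"
proof -
  have "continuous_on (cdom c) (H t)" if c: "c \<in> A" for c
  proof -
    have "continuous_on (cmap c ` cdom c) (H t \<circ> cinv c)"
      using smooth_hamiltonian_slice_differentiable[OF assms c]
      unfolding continuous_on_eq_continuous_within by (blast intro: differentiable_imp_continuous_within)
    from continuous_on_compose[OF homeomorphism_cont1[OF chart_homeomorphism[OF c]] this]
    show ?thesis by (rule continuous_on_eq) (simp add: cinv_cmap c)
  qed
  then have "continuous_on (\<Union>c\<in>A. cdom c) (H t)"
    by (intro continuous_on_open_UN open_cdom) auto
  then show ?thesis using atlas unfolding smooth_atlas_def by metis
qed

lemma tau_at_interior_min:
  assumes \<theta>: "one_form A \<theta>" "nondegenerate A (ext_deriv \<theta>)" and H: "smooth_hamiltonian A H"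
    and p: "p \<notin> boundary A" and min: "\<And>q. H t p \<le> H t q"
  shows "tau A \<theta> H t p = H t p"
proof -
  define c where "c = chart_at A p"
  have c: "c \<in> A" "p \<in> cdom c" unfolding c_def by (rule chart_at)+
  define S x where "S = cmap c ` cdom c" and "x = cmap c p"
  have S: "openin (top_of_set half_space) S" "x \<in> S"
    using openin_cmap[OF c(1)] c(2) by (auto simp: S_def x_def)
  have "x \<in> half_space" using openin_subset[OF S(1)] S(2) by auto
  have "(H t \<circ> cinv c) differentiable (at x within S)"
    using smooth_hamiltonian_slice_differentiable[OF H c] unfolding S_def x_def .
  then have "(H t \<circ> cinv c) differentiable (at x within half_space)"
    unfolding at_within_half_space[OF S] .
  then have dH: "differential (H t) c p = (\<lambda>v. 0)"
    unfolding differential_def x_def[symmetric]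
    using derivative_eq_0_at_interior_min[OF _ _ _ S, of "H t \<circ> cinv c"] interior_iff[OF c] p min
    by (simp add: frechet_derivative_works x_def cinv_cmap c)
  \<comment> \<open>The first term of \<open>ext_deriv\<close> vanishes by linearity of the
    derivative. The second differentiates the value of \<open>\<theta>\<close> on the zero vector,
    which is known to be 0 only on the chart image \<open>S\<close>, hence the derivative within
    \<open>S\<close>.\<close>
  have "ext_deriv \<theta> c p 0 v = 0" for v
  proof -
    have "smooth_on S (\<lambda>y. \<theta> c (cinv c y) v)"
      using \<theta>(1) c(1) unfolding one_form_def S_def by blast
    from smooth_on_half_space_derivative[OF S(1) this S(2)] have "Dh (\<lambda>y. \<theta> c (cinv c y) v) x 0 = 0"
      using has_derivative_linear linear_0 by blast
    moreover have "Dh (\<lambda>y. \<theta> c (cinv c y) 0) x = (\<lambda>v. 0)"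
    proof (rule half_space_derivative_unique[OF _ \<open>x \<in> half_space\<close>])
      have "\<theta> c (cinv c y) 0 = 0" if "y \<in> S" for y
        using that \<theta>(1) c(1) by (auto simp: S_def cinv_cmap one_form_def linear_0)
      then show "((\<lambda>y. \<theta> c (cinv c y) 0) has_derivative (\<lambda>v. 0)) (at x within half_space)"
        unfolding at_within_half_space[OF S]
        by (intro has_derivative_transform[OF S(2) _ has_derivative_const[of 0]]) auto
    qed
    ultimately show ?thesis by (simp add: ext_deriv_def x_def)
  qed
  \<comment> \<open>Zero solves the defining equation of the dual vector field, and nondegeneracy
    gives the uniqueness that \<open>THE\<close> demands.\<close>
  then have "ham_vfield \<theta> (H t) c p = 0"
    unfolding ham_vfield_def dual_vfield_def dH
    using \<theta>(2) c by (intro the_equality) (auto simp: nondegenerate_def)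
  moreover have "\<theta> c p 0 = 0" using \<theta>(1) c by (simp add: one_form_def linear_0)
  ultimately show ?thesis by (simp add: tau_def Let_def c_def)
qed

end

subsection \<open>Positivity of Hamiltonians\<close>

context
  fixes A :: "('w::t2_space, 'e::euclidean_space) chart set" and \<theta> :: "('w, 'e) form1"
  assumes liouville: "liouville_domain A \<theta>"
begin

lemma Hams_pos:
  assumes H: "H \<in> Hams A \<theta>" and w: "w \<notin> boundary A"
  shows "0 < H t w"
proof -
  have L: "smooth_atlas A" "one_form A \<theta>" "nondegenerate A (ext_deriv \<theta>)"
    and "compact (UNIV :: 'w set)"
    using liouville unfolding liouville_domain_def by blast+
  have smooth: "smooth_hamiltonian A H" and tau: "tau A \<theta> H t p > 0" for p
    using H unfolding Hams_def by blast+
  obtain m where m: "H t m \<le> H t q" for q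
    using continuous_attains_inf[OF \<open>compact UNIV\<close> _ smooth_hamiltonian_continuous[OF L(1) smooth]] by blast
  have pos: "0 < H t p" if "p \<notin> boundary A" "\<And>q. H t p \<le> H t q" for p
    using tau_at_interior_min[OF L smooth that] tau[of p] by simp
  show ?thesis
  proof (cases "m \<in> boundary A")
    \<comment> \<open>Here \<open>H t\<close> is nonnegative. If it vanished at the interior point
      \<open>w\<close>, then \<open>w\<close> would itself be a minimum and \<open>pos\<close> would
      give a contradiction.\<close>
    case True
    then have "H t m = 0" using H by (simp add: Hams_def)
    then show ?thesis using pos[OF w] m by (metis order_le_less)
  next
    case False
    then show ?thesis using pos[of m] m[of w] m by fastforce
  qed
qed

lemma Symp_boundary_iff: "\<psi> \<in> Symp A \<theta> \<Longrightarrow> \<psi> p \<in> boundary A \<longleftrightarrow> p \<in> boundary A"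
  using liouville diffeo_boundary_iff unfolding liouville_domain_def Symp_def by blast

end

subsection \<open>The distances\<close>

text \<open>Comparing with real bounds \<open>c\<close> only, and moving the logarithm to the other
  side, treats the values of \<open>ln_ext\<close> at nonpositive and infinite arguments uniformly,
  because \<open>exp c\<close> is positive and finite.\<close>

lemma ln_ext_le_iff: "ln_ext x \<le> ereal c \<longleftrightarrow> x \<le> ereal (exp c)"
proof (cases x)
  case (real r)
  show ?thesis
  proof (cases "r \<le> 0")
    case True
    then show ?thesis using real order_trans[OF True exp_ge_zero[of c]] by (simp add: ln_ext_def)
  next
    case False
    then show ?thesis using real by (simp add: ln_ext_def) (metis exp_le_cancel_iff exp_ln not_le)
  qed
qed (simp_all add: ln_ext_def)

lemma ln_ext_SUP_le_iff:
  "ln_ext (SUP (t, w)\<in>T \<times> W. ereal (f t w)) \<le> ereal c \<longleftrightarrow> (\<forall>t\<in>T. \<forall>w\<in>W. f t w \<le> exp c)"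
  by (auto simp: ln_ext_le_iff SUP_le_iff)

text \<open>Nonnegativity rules out sums of opposite infinities, so on a nonempty index set the
  infimum commutes with adding a term, one variable at a time.\<close>

lemma INF_add_le:
  fixes f g :: "'a \<Rightarrow> ereal"
  assumes "\<And>i. i \<in> I \<Longrightarrow> 0 \<le> f i" "\<And>i. i \<in> I \<Longrightarrow> 0 \<le> g i" and ne: "I \<noteq> {}"
    and le: "\<And>i j. i \<in> I \<Longrightarrow> j \<in> I \<Longrightarrow> h \<le> f i + g j"
  shows "h \<le> (INF i\<in>I. f i) + (INF j\<in>I. g j)"
proof -
  have "0 \<le> (INF j\<in>I. g j)" using assms(2) by (intro INF_greatest)
  then have "(INF j\<in>I. g j) \<noteq> -\<infinity>" by auto
  from INF_ereal_add_left[OF ne this assms(1)]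
  have "(INF i\<in>I. f i) + (INF j\<in>I. g j) = (INF i\<in>I. f i + (INF j\<in>I. g j))" by simp
  moreover have "f i + (INF j\<in>I. g j) = (INF j\<in>I. f i + g j)" if "i \<in> I" for i
    using assms(1)[OF that] by (intro INF_ereal_add_right[symmetric] ne assms(2)) auto
  ultimately show ?thesis using le by (auto intro!: INF_greatest)
qed

lemma Lawvere_Tun:
  fixes A :: "('w::t2_space, 'e::euclidean_space) chart set"
  assumes L: "liouville_domain A \<theta>"
  shows "lawvere_metric_category (Hams A \<theta>) (hom_Tun A \<theta>)"
proof -
  have atlas: "smooth_atlas A" and "one_form A \<theta>" using L by (auto simp: liouville_domain_def)
  then have id: "id \<in> Symp A \<theta>" by (rule Symp_id)
  define F where "F H G \<psi> = max (ln_ext (SUP (t, w) \<in> UNIV \<times> Int_mfd A. ereal (H t w / G t (\<psi> w)))) 0"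
    for H G :: "circle \<Rightarrow> 'w \<Rightarrow> real" and \<psi>
  have F0: "0 \<le> F H G \<psi>" for H G \<psi> by (simp add: F_def)
  have F_le: "F H G \<psi> \<le> ereal c \<longleftrightarrow> 0 \<le> c \<and> (\<forall>t. \<forall>w\<in>Int_mfd A. H t w / G t (\<psi> w) \<le> exp c)" for H G \<psi> c
    unfolding F_def max.bounded_iff ln_ext_SUP_le_iff by auto
  have hom: "hom_Tun A \<theta> H G = (INF \<psi>\<in>Symp A \<theta>. F H G \<psi>)" for H G
    by (simp add: hom_Tun_def F_def)
  have nonneg: "0 \<le> hom_Tun A \<theta> H G" for H G
    unfolding hom by (intro INF_greatest F0)
  have refl: "hom_Tun A \<theta> H H = 0" for H
  proof -
    \<comment> \<open>The quotient of a number by itself is 1, or 0 when that number is 0, so the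
      bound \<open>exp 0\<close> holds for every \<open>H\<close>.\<close>
    have "F H H id \<le> ereal 0" unfolding F_le by simp
    then have "hom_Tun A \<theta> H H \<le> 0" unfolding hom using INF_lower2[OF id] by (simp add: zero_ereal_def)
    with nonneg show ?thesis by (rule antisym[rotated])
  qed
  have triangle: "F H1 H3 (\<psi> \<circ> \<phi>) \<le> F H1 H2 \<phi> + F H2 H3 \<psi>"
    if H: "H1 \<in> Hams A \<theta>" "H2 \<in> Hams A \<theta>" "H3 \<in> Hams A \<theta>" and \<phi>: "\<phi> \<in> Symp A \<theta>" and \<psi>: "\<psi> \<in> Symp A \<theta>"
    for H1 H2 H3 \<phi> \<psi>
  \<comment> \<open>Both terms are nonnegative, so if one is infinite the right-hand side is
    infinite; only the case of two real values needs an argument.\<close>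
  proof (cases "F H1 H2 \<phi>" "F H2 H3 \<psi>" rule: ereal2_cases)
    case (real_real a b)
    then have ab: "0 \<le> a" "0 \<le> b"
      and a: "\<And>t w. w \<notin> boundary A \<Longrightarrow> H1 t w / H2 t (\<phi> w) \<le> exp a"
      and b: "\<And>t w. w \<notin> boundary A \<Longrightarrow> H2 t w / H3 t (\<psi> w) \<le> exp b"
      using F_le[of H1 H2 \<phi> a] F_le[of H2 H3 \<psi> b] by auto
    have "H1 t w / H3 t (\<psi> (\<phi> w)) \<le> exp (a + b)" if w: "w \<notin> boundary A" for t w
    proof -
      have int: "\<phi> w \<notin> boundary A" "\<psi> (\<phi> w) \<notin> boundary A"
        using w Symp_boundary_iff[OF L] \<phi> \<psi> by blast+
      have pos: "0 < H1 t w" "0 < H2 t (\<phi> w)" "0 < H3 t (\<psi> (\<phi> w))"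
        using Hams_pos[OF L] H w int by blast+
      have "H1 t w / H3 t (\<psi> (\<phi> w)) = (H1 t w / H2 t (\<phi> w)) * (H2 t (\<phi> w) / H3 t (\<psi> (\<phi> w)))"
        using pos by simp
      also have "\<dots> \<le> exp a * exp b"
        using a[OF w] b[OF int(1)] pos by (intro mult_mono) auto
      finally show ?thesis by (simp add: exp_add)
    qed
    then have "F H1 H3 (\<psi> \<circ> \<phi>) \<le> ereal (a + b)" unfolding F_le using ab by simp
    with real_real show ?thesis by simp
  qed (use F0[of H1 H2 \<phi>] F0[of H2 H3 \<psi>] in auto)
  have "hom_Tun A \<theta> H1 H3 \<le> hom_Tun A \<theta> H1 H2 + hom_Tun A \<theta> H2 H3"
    if H: "H1 \<in> Hams A \<theta>" "H2 \<in> Hams A \<theta>" "H3 \<in> Hams A \<theta>" for H1 H2 H3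
    unfolding hom
  \<comment> \<open>Each pair of candidates for the two summands yields the competitor
    \<open>\<psi> \<circ> \<phi>\<close> on the left.\<close>
  proof (rule INF_add_le)
    fix \<phi> \<psi> assume "\<phi> \<in> Symp A \<theta>" "\<psi> \<in> Symp A \<theta>"
    with triangle[OF H this] Symp_compose[OF atlas this]
    show "(INF \<psi>\<in>Symp A \<theta>. F H1 H3 \<psi>) \<le> F H1 H2 \<phi> + F H2 H3 \<psi>"
      by (intro INF_lower2)
  qed (use id F0 in auto)
  with nonneg refl show ?thesis by (simp add: lawvere_metric_category_def)
qed

lemma hom_sym_Tun_eq_d_T:
  fixes A :: "('w::t2_space, 'e::euclidean_space) chart set"
  assumes L: "liouville_domain A \<theta>" and HG: "H \<in> Hams A \<theta>" "G \<in> Hams A \<theta>"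
  shows "hom_sym_Tun A \<theta> H G = d_T A \<theta> H G"
proof -
  have atlas: "smooth_atlas A" using L by (auto simp: liouville_domain_def)
  define F where "F \<psi> = ln_ext (SUP (t, w) \<in> UNIV \<times> Int_mfd A. ereal (max (H t w / G t (\<psi> w)) (G t (\<psi> w) / H t w)))"
    for \<psi>
  have hom: "hom_sym_Tun A \<theta> H G = (INF \<psi>\<in>Symp A \<theta>. F \<psi>)"
    by (simp add: hom_sym_Tun_def F_def)
  have pos: "0 < H t w" "0 < G t (\<psi> w)" if "\<psi> \<in> Symp A \<theta>" "w \<notin> boundary A" for \<psi> t w
    using that Hams_pos[OF L] HG Symp_boundary_iff[OF L that(1)] by blast+
  have bound: "1 / C * H t w \<le> G t (\<psi> w) \<and> G t (\<psi> w) \<le> C * H t w \<longleftrightarrow>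
      max (H t w / G t (\<psi> w)) (G t (\<psi> w) / H t w) \<le> C"
    if "\<psi> \<in> Symp A \<theta>" "w \<notin> boundary A" "0 < C" for C \<psi> t w
    using pos[OF that(1,2), of t] that(3) by (simp add: field_simps)
  have vanish: "H t w = 0" "G t (\<psi> w) = 0" if "\<psi> \<in> Symp A \<theta>" "w \<in> boundary A" for \<psi> t w
    using that HG Symp_boundary_iff[OF L that(1)] by (simp_all add: Hams_def)
  \<comment> \<open>The supremum sees the interior only, while \<open>d_T\<close> constrains all
    points. The gap closes because both Hamiltonians vanish on the boundary, which
    \<open>\<psi>\<close> preserves.\<close>
  have F_le: "F \<psi> \<le> ereal (ln C) \<longleftrightarrow> (\<forall>t w. 1 / C * H t w \<le> G t (\<psi> w) \<and> G t (\<psi> w) \<le> C * H t w)"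
    if \<psi>: "\<psi> \<in> Symp A \<theta>" and C: "0 < C" for \<psi> C
  proof -
    have "F \<psi> \<le> ereal (ln C) \<longleftrightarrow>
        (\<forall>t. \<forall>w\<in>Int_mfd A. max (H t w / G t (\<psi> w)) (G t (\<psi> w) / H t w) \<le> C)"
      unfolding F_def ln_ext_SUP_le_iff using C by simp
    also have "\<dots> \<longleftrightarrow> (\<forall>t. \<forall>w\<in>Int_mfd A. 1 / C * H t w \<le> G t (\<psi> w) \<and> G t (\<psi> w) \<le> C * H t w)"
      using bound[OF \<psi> _ C] by (metis ComplD)
    also have "\<dots> \<longleftrightarrow> (\<forall>t w. 1 / C * H t w \<le> G t (\<psi> w) \<and> G t (\<psi> w) \<le> C * H t w)"
    proof (intro iffI allI)
      fix t w
      assume "\<forall>t. \<forall>w\<in>Int_mfd A. 1 / C * H t w \<le> G t (\<psi> w) \<and> G t (\<psi> w) \<le> C * H t w"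
      then show "1 / C * H t w \<le> G t (\<psi> w) \<and> G t (\<psi> w) \<le> C * H t w"
        using vanish[OF \<psi>, of w t] by (cases "w \<in> boundary A") auto
    qed blast
    finally show ?thesis .
  qed
  \<comment> \<open>\<open>d_T\<close> admits only constants with \<open>ln C\<close> nonnegative,
    while \<open>hom_sym_Tun\<close> is not truncated at 0. At any interior point a positive
    quotient or its inverse is at least 1.\<close>
  have F_nonneg: "0 \<le> r" if \<psi>: "\<psi> \<in> Symp A \<theta>" and "F \<psi> \<le> ereal r" for \<psi> r
  proof -
    obtain w where w: "w \<notin> boundary A" using interior_nonempty[OF atlas] by blast
    fix t :: circle
    let ?q = "H t w / G t (\<psi> w)"
    have "max ?q (1 / ?q) \<le> exp r"
      using that(2) w unfolding F_def ln_ext_SUP_le_iff by simp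
    moreover have "1 \<le> max ?q (1 / ?q)"
      using pos[OF \<psi> w, of t] by (auto simp: le_max_iff_disj field_simps)
    ultimately show ?thesis by (metis order_trans one_le_exp_iff)
  qed
  show ?thesis
  proof (rule antisym)
    show "hom_sym_Tun A \<theta> H G \<le> d_T A \<theta> H G"
      unfolding d_T_def hom
    proof (rule Inf_greatest, clarify)
      fix C :: real and \<phi>
      assume "0 < C" "\<phi> \<in> Symp A \<theta>"
        "\<forall>t w. 1 / C * H t w \<le> G t (\<phi> w) \<and> G t (\<phi> w) \<le> C * H t w"
      with F_le show "(INF \<psi>\<in>Symp A \<theta>. F \<psi>) \<le> ereal (ln C)" by (intro INF_lower2) auto
    qed
    show "d_T A \<theta> H G \<le> hom_sym_Tun A \<theta> H G"
      unfolding hom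
    proof (rule INF_greatest)
      fix \<psi> assume \<psi>: "\<psi> \<in> Symp A \<theta>"
      show "d_T A \<theta> H G \<le> F \<psi>"
      \<comment> \<open>It suffices to test real upper bounds \<open>r\<close> of
        \<open>F \<psi>\<close>, which makes an infinite value harmless. The constant
        \<open>C = exp r\<close> is then admissible in \<open>d_T\<close>.\<close>
      proof (rule ereal_le_real)
        fix r assume r: "F \<psi> \<le> ereal r"
        then have "F \<psi> \<le> ereal (ln (exp r))" by simp
        with F_nonneg[OF \<psi> r] F_le[OF \<psi>, of "exp r"] \<psi> show "d_T A \<theta> H G \<le> ereal r"
          unfolding d_T_def by (intro Inf_lower CollectI exI[of _ "exp r"]) auto
      qed
    qed
  qed
qed

theorem theorem8:
  fixes A :: "('w::t2_space, 'e::euclidean_space) chart set" and \<theta> :: "('w, 'e) form1"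
  assumes "liouville_domain A \<theta>"
  shows "lawvere_metric_category (Hams A \<theta>) (hom_Tun A \<theta>) \<and>
    (\<forall>H\<in>Hams A \<theta>. \<forall>G\<in>Hams A \<theta>. hom_sym_Tun A \<theta> H G = d_T A \<theta> H G)"
  using Lawvere_Tun[OF assms] hom_sym_Tun_eq_d_T[OF assms] by blast

end
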